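(* Let $\epsilon>0$, $\delta\in(0,1]$, $T\ge1$. Suppose $\|\lambda^{(0)}-\lambda^*\|_2\le M$ for some $M>0$, and suppose the differentially private resource allocation algorithm described in the context (without momentum) is run for $T$ iterations with a fixed step-size $\nu^{(t)}=\nu$ and with independent noise components $$\omega_{k,j}^{(t)}\sim\mathcal N\left(0,\frac{T\,m\,c_j^{2}}{2\rho(\epsilon,\delta)}\right),\qquad \rho(\epsilon,\delta)=\left(\sqrt{\log(1/\delta)+\epsilon}-\sqrt{\log(1/\delta)}\right)^{2},$$ $k=1,\dots,K$, $j=1,\dots,m$, $t=0,\dots,T-1$ (so as to provide $(\epsilon,\delta)$-local differential privacy). Then there exists a step-size $\nu>0$ for which $$\min_{t=0,1,\dots,T}\ \mathbb E[G^{(t)}]\le\frac{MB}{\sqrt T},\qquad\text{where}\quad B=\|c\|_2\left(\frac{T\,m\,K}{2\rho(\epsilon,\delta)}+(K-1)^2\right)^{1/2}.$$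
   Context: Setting. There are $K>1$ parties and $m\ge 1$ shared resources with capacity vector $c\in[0,\infty)^m$. Party $k$ has a private dataset $\mathcal D_k=\{A_k,B_k,b_k,u_k\}$ with $A_k\in\mathbb R^{m\times n_k}$, $B_k\in\mathbb R^{m_k\times n_k}$, $b_k\in\mathbb R^{m_k}$, $u_k\in\mathbb R^{n_k}$. The resource-sharing problem is $$\max\ \sum_{k=1}^K u_k^\top x_k\quad\text{s.t.}\quad A_kx_k\le s_k,\ B_kx_k\le b_k,\ 0\le s_k\le c\ (k=1,\dots,K),\quad \sum_{k=1}^K s_k=c,$$ (the constraint $s_k\le c$ is assumed to be included for every party). Relaxing $\sum_k s_k=c$ with a multiplier $\lambda\in\mathbb R^m$ gives the Lagrangian $$\mathcal L(x,s,\lambda)=c^\top\lambda+\sum_{k=1}^K(u_k^\top x_k-s_k^\top\lambda),\qquad x=(x_1,\dots,x_K),\ s=(s_1,\dots,s_K),$$ and the sub-problems $$g(\lambda;\mathcal D_k)=\max_{x_k,s_k}\{u_k^\top x_k-s_k^\top\lambda:\ A_kx_k\le s_k,\ B_kx_k\le b_k,\ 0\le s_k\le c\}.$$ It is assumed that every sub-problem has an optimal solution for every $\lambda$ and that the resource-sharing problem has an optimal solution. The Lagrangian dual problem is $\min_\lambda\{c^\top\lambda+\sum_k g(\lambda;\mathcal D_k)\}$; $\lambda^*$ denotes an optimal solution of it and $(x^*,s^* )$ an optimal solution of the resource-sharing problem, so that $\mathcal L(x^*,s^*,\lambda^* )$ is the common optimal value. Algorithm. Start with $\lambda^{(0)}=0$.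 With step-sizes $\nu^{(t)}$, at each iteration $t$ perform $$(x_k^{(t)},s_k^{(t)})=\arg\max\, g(\lambda^{(t)};\mathcal D_k),\qquad \tilde s_k^{(t)}=s_k^{(t)}+\omega_k^{(t)},\qquad k=1,\dots,K,$$ $$\lambda^{(t+1)}=\lambda^{(t)}-\nu^{(t)}\Big(c-\sum_{k=1}^K\tilde s_k^{(t)}\Big),$$ where $\arg\max$ denotes a fixed (measurable) selection of a maximizer and $\omega_k^{(t)}=(\omega_{k,1}^{(t)},\dots,\omega_{k,m}^{(t)})$ are random noise vectors, independent over all $k,j,t$. Also $(x^{(T)},s^{(T)})$ denotes the sub-problem solutions at $\lambda^{(T)}$. Optimality gap: $G^{(t)}=\mathcal L(x^{(t)},s^{(t)},\lambda^{(t)})-\mathcal L(x^*,s^*,\lambda^* )$ for $t\ge0$. $\mathcal N(0,0)$ denotes the point mass at $0$. *)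

theory Defs
  imports "HOL-Probability.Probability"
begin

text \<open>
  The \<open>m\<close> shared resources are indexed by a finite type \<open>'m\<close>, so resource vectors live in
  \<open>real^'m\<close>. The dimensions \<open>n\<^sub>k\<close> and \<open>m\<^sub>k\<close> differ from party to party and are therefore
  stored with the data: a vector of \<open>\<real>\<^sup>n\<close> is an extensional function on \<open>{..<n}\<close>, i.e. a point
  of the product measurable space \<open>Pi\<^sub>M {..<n} (\<lambda>_. borel)\<close>. Only the entries of a data set with
  column index below \<open>num_vars\<close> and row index below \<open>num_cons\<close> are ever used.
\<close>

record 'm private_data =
  num_vars :: nat
  num_cons :: nat
  res_mat :: "'m \<Rightarrow> nat \<Rightarrow> real"
  con_mat :: "nat \<Rightarrow> nat \<Rightarrow> real"
  con_rhs :: "nat \<Rightarrow> real"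
  util_vec :: "nat \<Rightarrow> real"

definition utility :: "'m::finite private_data \<Rightarrow> (nat \<Rightarrow> real) \<Rightarrow> real" where
  "utility D x = (\<Sum>j<num_vars D. util_vec D j * x j)"

definition party_feasible ::
    "real^'m \<Rightarrow> 'm::finite private_data \<Rightarrow> (nat \<Rightarrow> real) \<Rightarrow> real^'m \<Rightarrow> bool" where
  "party_feasible c D x s \<longleftrightarrow>
     x \<in> {..<num_vars D} \<rightarrow>\<^sub>E UNIV \<and>
     (\<forall>i. (\<Sum>j<num_vars D. res_mat D i j * x j) \<le> s $ i) \<and>
     (\<forall>l<num_cons D. (\<Sum>j<num_vars D. con_mat D l j * x j) \<le> con_rhs D l) \<and>
     0 \<le> s \<and> s \<le> c"

text \<open>
  The \<open>K\<close> parties are indexed by \<open>{..<K}\<close>; components of \<open>x\<close>, \<open>s\<close> and \<open>D\<close> at indices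
  \<open>\<ge> K\<close> play no role. The multiplier, usually written \<open>\<lambda>\<close>, is called \<open>\<mu>\<close> here.
\<close>

definition resource_sharing_optimal ::
    "real^'m \<Rightarrow> nat \<Rightarrow> (nat \<Rightarrow> 'm::finite private_data) \<Rightarrow>
     (nat \<Rightarrow> nat \<Rightarrow> real) \<Rightarrow> (nat \<Rightarrow> real^'m) \<Rightarrow> bool" where
  "resource_sharing_optimal c K D x s \<longleftrightarrow>
     is_arg_max (\<lambda>(x, s). \<Sum>k<K. utility (D k) (x k))
       (\<lambda>(x, s). (\<forall>k<K. party_feasible c (D k) (x k) (s k)) \<and> (\<Sum>k<K. s k) = c) (x, s)"

definition lagrangian ::
    "real^'m \<Rightarrow> nat \<Rightarrow> (nat \<Rightarrow> 'm::finite private_data) \<Rightarrow>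
     (nat \<Rightarrow> nat \<Rightarrow> real) \<Rightarrow> (nat \<Rightarrow> real^'m) \<Rightarrow> real^'m \<Rightarrow> real" where
  "lagrangian c K D x s \<mu> = c \<bullet> \<mu> + (\<Sum>k<K. utility (D k) (x k) - s k \<bullet> \<mu>)"

definition subproblem_optimal ::
    "real^'m \<Rightarrow> 'm::finite private_data \<Rightarrow> real^'m \<Rightarrow> (nat \<Rightarrow> real) \<times> (real^'m) \<Rightarrow> bool" where
  "subproblem_optimal c D \<mu> =
     is_arg_max (\<lambda>(x, s). utility D x - s \<bullet> \<mu>) (\<lambda>(x, s). party_feasible c D x s)"

text \<open>A supremum in \<open>real\<close>; it is the maximum whenever the sub-problem has an optimal solution.\<close>

definition subproblem_value :: "real^'m \<Rightarrow> 'm::finite private_data \<Rightarrow> real^'m \<Rightarrow> real" where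
  "subproblem_value c D \<mu> =
     (SUP (x, s) \<in> {(x, s). party_feasible c D x s}. utility D x - s \<bullet> \<mu>)"

definition dual_optimal ::
    "real^'m \<Rightarrow> nat \<Rightarrow> (nat \<Rightarrow> 'm::finite private_data) \<Rightarrow> real^'m \<Rightarrow> bool" where
  "dual_optimal c K D =
     is_arg_min (\<lambda>\<mu>. c \<bullet> \<mu> + (\<Sum>k<K. subproblem_value c (D k) \<mu>)) (\<lambda>_. True)"

definition argmax_selection ::
    "real^'m \<Rightarrow> 'm::finite private_data \<Rightarrow> (real^'m \<Rightarrow> (nat \<Rightarrow> real) \<times> (real^'m)) \<Rightarrow> bool" where
  "argmax_selection c D \<sigma> \<longleftrightarrow>
     (\<forall>\<mu>. subproblem_optimal c D \<mu> (\<sigma> \<mu>)) \<and>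
     \<sigma> \<in> borel \<rightarrow>\<^sub>M Pi\<^sub>M {..<num_vars D} (\<lambda>_. borel) \<Otimes>\<^sub>M borel"

text \<open>
  The iterates for a fixed realisation \<open>w\<close> of the noise: \<open>\<sigma> k\<close> is the selection used by party
  \<open>k\<close>, \<open>\<nu> t\<close> the step-size and \<open>w t k\<close> the noise vector of party \<open>k\<close> in iteration \<open>t\<close>.
\<close>

primrec multiplier ::
    "real^'m \<Rightarrow> nat \<Rightarrow> (nat \<Rightarrow> real^'m \<Rightarrow> (nat \<Rightarrow> real) \<times> (real^'m)) \<Rightarrow>
     (nat \<Rightarrow> real) \<Rightarrow> (nat \<Rightarrow> nat \<Rightarrow> real^'m::finite) \<Rightarrow> nat \<Rightarrow> real^'m" where
  "multiplier c K \<sigma> \<nu> w 0 = 0"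
| "multiplier c K \<sigma> \<nu> w (Suc t) =
     multiplier c K \<sigma> \<nu> w t
     - \<nu> t *\<^sub>R (c - (\<Sum>k<K. snd (\<sigma> k (multiplier c K \<sigma> \<nu> w t)) + w t k))"

text \<open>The reference point \<open>(x_opt, s_opt, mu_opt)\<close> is the triple of optimal solutions.\<close>

definition optimality_gap ::
    "real^'m \<Rightarrow> nat \<Rightarrow> (nat \<Rightarrow> 'm::finite private_data) \<Rightarrow>
     (nat \<Rightarrow> real^'m \<Rightarrow> (nat \<Rightarrow> real) \<times> (real^'m)) \<Rightarrow>
     (nat \<Rightarrow> nat \<Rightarrow> real) \<Rightarrow> (nat \<Rightarrow> real^'m) \<Rightarrow> real^'m \<Rightarrow>
     (nat \<Rightarrow> real) \<Rightarrow> (nat \<Rightarrow> nat \<Rightarrow> real^'m) \<Rightarrow> nat \<Rightarrow> real" where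
  "optimality_gap c K D \<sigma> x_opt s_opt mu_opt \<nu> w t =
     (let \<mu> = multiplier c K \<sigma> \<nu> w t
      in lagrangian c K D (\<lambda>k. fst (\<sigma> k \<mu>)) (\<lambda>k. snd (\<sigma> k \<mu>)) \<mu>
         - lagrangian c K D x_opt s_opt mu_opt)"

text \<open>
  The second parameter is the variance, whereas \<^const>\<open>normal_density\<close> takes the standard
  deviation; variance \<open>0\<close> gives the point mass at the mean.
\<close>

definition gaussian :: "real \<Rightarrow> real \<Rightarrow> real measure" where
  "gaussian a v =
     (if v = 0 then return borel a
      else density lborel (\<lambda>x. ennreal (normal_density a (sqrt v) x)))"

definition rho :: "real \<Rightarrow> real \<Rightarrow> real" where
  "rho \<epsilon> \<delta> = (sqrt (ln (1 / \<delta>) + \<epsilon>) - sqrt (ln (1 / \<delta>)))\<^sup>2"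

end

theory Submission
  imports Defs
begin

text \<open>
  The algorithm is stochastic subgradient descent on the Lagrangian dual function. Write \<open>\<phi>\<close> for
  that function. At a multiplier \<open>\<mu>\<close> the resources left over by the selected sub-problem solutions
  form a subgradient \<open>g\<close> of \<open>\<phi>\<close>, and the update uses \<open>g - \<xi>\<close>, where \<open>\<xi>\<close> is the sum of the noise
  vectors of all parties.

  Three facts carry the bound. First, the optimality gap is \<open>\<phi> \<mu> - \<phi> mu_opt\<close>, because the
  Lagrangian at the optimal triple is the primal optimum and \<open>\<phi> mu_opt\<close> has the same value. This is
  strong duality for linear programs (\<open>strong_duality\<close>). It is derived from Fourier--Motzkin
  elimination (\<open>fourier_motzkin\<close>): the pairs of a total allocation and a utility reached by it form
  a polyhedron, and an inequality of that polyhedron which cuts off a utility just above the optimum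
  is a multiplier (\<open>near_optimal_multiplier\<close>). So the gap is nonnegative and at most
  \<open>g \<bullet> (\<mu> - mu_opt)\<close>.

  Second, the noise of one iteration is centred, independent of the current multiplier
  (\<open>indep_multiplier_noise\<close>), and its mean squared norm is \<open>|c|\<^sup>2 T m K / (2 \<rho>)\<close>
  (\<open>gaussian_noise_sum_moments\<close>); moreover \<open>|g| \<le> (K - 1) |c|\<close> (\<open>norm_slack_le\<close>). The mean squared
  norm of the perturbed subgradient is hence at most \<open>B\<^sup>2\<close>.

  Third, the distance to \<open>mu_opt\<close> telescopes (\<open>noisy_subgradient_descent\<close>): with a constant step-size
  \<open>\<nu>\<close> the expected gaps satisfy \<open>2 \<nu> (\<Sum>t<T. E G t) \<le> M\<^sup>2 + T \<nu>\<^sup>2 B\<^sup>2\<close>. The smallest of them is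
  bounded by their mean, and \<open>\<nu> = M / (B sqrt T)\<close> gives \<open>M B / sqrt T\<close>.
\<close>

section \<open>Fourier--Motzkin elimination\<close>

text \<open>
  A system of linear inequalities is represented by a finite set of affine forms, each required
  to be nonnegative. Points are plain functions on an arbitrary index type and only the
  coordinates in \<open>J\<close> are read, so the number of variables may depend on the data and a single
  coordinate can be eliminated without changing the type.
\<close>

definition affine_form :: "'j set \<Rightarrow> (('j \<Rightarrow> real) \<Rightarrow> real) \<Rightarrow> bool" where
  "affine_form J f \<longleftrightarrow> (\<exists>\<alpha> a. \<forall>y. f y = \<alpha> + (\<Sum>j\<in>J. a j * y j))"

lemma affine_form_const: "affine_form J (\<lambda>_. r)"
  unfolding affine_form_def by (rule exI[of _ r], rule exI[of _ "\<lambda>_. 0"]) simp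

lemma affine_form_coord:
  assumes "finite J" "j \<in> J"
  shows "affine_form J (\<lambda>y. y j)"
  unfolding affine_form_def
  by (rule exI[of _ 0], rule exI[of _ "\<lambda>i. if i = j then 1 else 0"])
     (use assms in \<open>simp add: if_distrib[of "\<lambda>b. b * _"] cong: if_cong\<close>)

lemma affine_form_add:
  assumes "affine_form J f" "affine_form J g"
  shows "affine_form J (\<lambda>y. f y + g y)"
proof -
  obtain \<alpha> a \<beta> b where "\<forall>y. f y = \<alpha> + (\<Sum>j\<in>J. a j * y j)" "\<forall>y. g y = \<beta> + (\<Sum>j\<in>J. b j * y j)"
    using assms unfolding affine_form_def by blast
  then show ?thesis unfolding affine_form_def
    by (intro exI[of _ "\<alpha> + \<beta>"] exI[of _ "\<lambda>j. a j + b j"]) (simp add: sum.distrib algebra_simps)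
qed

lemma affine_form_cmult:
  assumes "affine_form J f"
  shows "affine_form J (\<lambda>y. r * f y)"
proof -
  obtain \<alpha> a where "\<forall>y. f y = \<alpha> + (\<Sum>j\<in>J. a j * y j)"
    using assms unfolding affine_form_def by blast
  then show ?thesis unfolding affine_form_def
    by (intro exI[of _ "r * \<alpha>"] exI[of _ "\<lambda>j. r * a j"]) (simp add: sum_distrib_left algebra_simps)
qed

lemma affine_form_diff:
  assumes "affine_form J f" "affine_form J g"
  shows "affine_form J (\<lambda>y. f y - g y)"
  using affine_form_add[OF assms(1) affine_form_cmult[OF assms(2), of "-1"]] by simp

lemma affine_form_sum:
  assumes "\<And>k. k \<in> A \<Longrightarrow> affine_form J (f k)"
  shows "affine_form J (\<lambda>y. \<Sum>k\<in>A. f k y)"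
  using assms
  by (induction A rule: infinite_finite_induct) (auto intro!: affine_form_const affine_form_add)

lemma affine_form_cong_on:
  assumes "affine_form J f" "\<And>j. j \<in> J \<Longrightarrow> x j = y j"
  shows "f x = f y"
  using assms by (auto simp: affine_form_def)

lemma affine_form_insertE:
  assumes "finite J" "j \<notin> J" "affine_form (insert j J) f"
  obtains r b where "affine_form J r" "\<And>y. f y = r y + b * y j"
proof -
  obtain \<alpha> a where "\<forall>y. f y = \<alpha> + (\<Sum>i\<in>insert j J. a i * y i)"
    using assms unfolding affine_form_def by blast
  then have "\<And>y. f y = (\<alpha> + (\<Sum>i\<in>J. a i * y i)) + a j * y j"
    using assms by simp
  moreover have "affine_form J (\<lambda>y. \<alpha> + (\<Sum>i\<in>J. a i * y i))"
    unfolding affine_form_def by blast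
  ultimately show ?thesis by (rule that[rotated])
qed

lemma finite_interval_nonempty:
  fixes A B :: "real set"
  assumes "finite A" "finite B" "\<And>a b. a \<in> A \<Longrightarrow> b \<in> B \<Longrightarrow> a \<le> b"
  shows "\<exists>t. (\<forall>a\<in>A. a \<le> t) \<and> (\<forall>b\<in>B. t \<le> b)"
proof (cases "A = {}")
  case True
  then show ?thesis using assms by (cases "B = {}") (auto intro!: exI[of _ "Min B"])
next
  case False
  then show ?thesis using assms by (intro exI[of _ "Max A"]) auto
qed

text \<open>
  One step of Fourier--Motzkin elimination. As a condition on \<open>y j\<close>, each form is a lower
  bound, an upper bound, or no condition at all, according to the sign of its coefficient \<open>b f\<close>
  of \<open>y j\<close>. A real number between finitely many lower and finitely many upper bounds exists iff
  every lower bound is at most every upper bound; after clearing the denominators this is again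
  a finite set of affine conditions, now on the remaining coordinates.
\<close>

lemma eliminate_variable:
  assumes J: "finite J" "j \<notin> J" and C: "finite C" "\<And>f. f \<in> C \<Longrightarrow> affine_form (insert j J) f"
  obtains C' where "finite C'" "\<And>g. g \<in> C' \<Longrightarrow> affine_form J g"
    "\<And>y. (\<forall>g\<in>C'. 0 \<le> g y) \<longleftrightarrow> (\<exists>t. \<forall>f\<in>C. 0 \<le> f (y(j := t)))"
proof -
  have "\<forall>f\<in>C. \<exists>r b. affine_form J r \<and> (\<forall>y. f y = r y + b * y j)"
    using affine_form_insertE[OF J C(2)] by metis
  then obtain r b where r: "\<And>f. f \<in> C \<Longrightarrow> affine_form J (r f)"
    and f: "\<And>f y. f \<in> C \<Longrightarrow> f y = r f y + b f * y j"
    by metis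
  define Z where "Z = {f\<in>C. b f = 0}"
  define L where "L = {f\<in>C. b f > 0}"
  define U where "U = {f\<in>C. b f < 0}"
  have fin: "finite Z" "finite L" "finite U"
    using C(1) by (auto simp: Z_def L_def U_def)
  define C' where "C' = r ` Z \<union> (\<lambda>(f, g) y. b f * r g y + (- b g) * r f y) ` (L \<times> U)"
  have upd: "f (y(j := t)) = r f y + b f * t" if "f \<in> C" for f y t
  proof -
    have "r f (y(j := t)) = r f y"
      using J(2) by (intro affine_form_cong_on[OF r[OF that]]) auto
    then show ?thesis using f[OF that, of "y(j := t)"] by simp
  qed
  have "(\<forall>g\<in>C'. 0 \<le> g y) \<longleftrightarrow> (\<exists>t. \<forall>f\<in>C. 0 \<le> f (y(j := t)))" for y
  proof
    assume nonneg: "\<forall>g\<in>C'. 0 \<le> g y"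
    have "- r f y / b f \<le> - r g y / b g" if "f \<in> L" "g \<in> U" for f g
    proof -
      have "0 \<le> b f * r g y + (- b g) * r f y"
        using nonneg that by (fastforce simp: C'_def)
      moreover have "0 < b f" "b g < 0" using that by (auto simp: L_def U_def)
      ultimately show ?thesis by (simp add: divide_simps mult_ac)
    qed
    then have "\<exists>t. (\<forall>a\<in>(\<lambda>f. - r f y / b f) ` L. a \<le> t) \<and> (\<forall>a\<in>(\<lambda>g. - r g y / b g) ` U. t \<le> a)"
      by (intro finite_interval_nonempty finite_imageI fin) auto
    then obtain t where t: "\<And>f. f \<in> L \<Longrightarrow> - r f y / b f \<le> t" "\<And>g. g \<in> U \<Longrightarrow> t \<le> - r g y / b g"
      by auto
    have "0 \<le> f (y(j := t))" if "f \<in> C" for f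
    proof -
      consider "f \<in> Z" | "f \<in> L" | "f \<in> U"
        using \<open>f \<in> C\<close> unfolding Z_def L_def U_def by (cases "b f" "0::real" rule: linorder_cases) auto
      then have "0 \<le> r f y + b f * t"
      proof cases
        case 1
        then show ?thesis using nonneg by (auto simp: C'_def Z_def)
      next
        case 2
        then show ?thesis using t(1)[OF 2] by (simp add: L_def divide_simps mult_ac)
      next
        case 3
        then show ?thesis using t(2)[OF 3] 3 neg_le_divide_eq[of "b f" t "- r f y"]
          by (simp add: U_def mult_ac)
      qed
      then show ?thesis using upd[OF that] by simp
    qed
    then show "\<exists>t. \<forall>f\<in>C. 0 \<le> f (y(j := t))" by blast
  next
    assume "\<exists>t. \<forall>f\<in>C. 0 \<le> f (y(j := t))"
    then obtain t where "\<forall>f\<in>C. 0 \<le> f (y(j := t))" by blast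
    then have t: "0 \<le> r f y + b f * t" if "f \<in> C" for f
      using upd[OF that] that by metis
    have "0 \<le> b f * r g y + (- b g) * r f y" if "f \<in> L" "g \<in> U" for f g
    proof -
      have "0 \<le> b f * (r g y + b g * t) + (- b g) * (r f y + b f * t)"
        using that t[of f] t[of g] unfolding L_def U_def
        by (intro add_nonneg_nonneg[OF mult_nonneg_nonneg mult_nonneg_nonneg]) auto
      then show ?thesis by (simp add: algebra_simps)
    qed
    moreover have "0 \<le> r f y" if "f \<in> Z" for f
      using t[of f] that by (simp add: Z_def)
    ultimately show "\<forall>g\<in>C'. 0 \<le> g y" by (auto simp: C'_def)
  qed
  moreover have "affine_form J g" if "g \<in> C'" for g
    using that unfolding C'_def
    by (auto simp: Z_def L_def U_def intro!: r affine_form_add affine_form_cmult affine_form_diff)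
  moreover have "finite C'" using fin by (simp add: C'_def)
  ultimately show ?thesis using that by blast
qed

text \<open>
  Iterated elimination: the projection of a polyhedron to the coordinates \<open>J'\<close> is a polyhedron.
  This is where duality comes from. The projection is an intersection of finitely many closed
  half-spaces, so a point outside it violates one of the projected inequalities, and that
  inequality is a separating hyperplane.
\<close>

lemma fourier_motzkin:
  assumes "finite J" "finite J'" "J \<inter> J' = {}"
    and "finite C" "\<And>f. f \<in> C \<Longrightarrow> affine_form (J \<union> J') f"
  shows "\<exists>C'. finite C' \<and> (\<forall>g\<in>C'. affine_form J' g) \<and>
    (\<forall>x. (\<forall>g\<in>C'. 0 \<le> g x) \<longleftrightarrow> (\<exists>y. (\<forall>j. j \<notin> J \<longrightarrow> y j = x j) \<and> (\<forall>f\<in>C. 0 \<le> f y)))"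
  using assms
proof (induction J arbitrary: C rule: finite_induct)
  case empty
  have "(\<exists>y. (\<forall>j. y j = x j) \<and> (\<forall>f\<in>C. 0 \<le> f y)) \<longleftrightarrow> (\<forall>f\<in>C. 0 \<le> f x)" for x
    by (metis ext)
  then show ?case using empty by auto
next
  case (insert j J)
  obtain C1 where C1: "finite C1" "\<And>g. g \<in> C1 \<Longrightarrow> affine_form (J \<union> J') g"
    "\<And>y. (\<forall>g\<in>C1. 0 \<le> g y) \<longleftrightarrow> (\<exists>t. \<forall>f\<in>C. 0 \<le> f (y(j := t)))"
    using insert.prems insert.hyps
    by (elim eliminate_variable[of "J \<union> J'" j C, rotated 4]) auto
  have "J \<inter> J' = {}" using insert.prems(2) by blast
  from insert.IH[OF insert.prems(1) this C1(1,2)] obtain C' where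
    C': "finite C'" "\<forall>g\<in>C'. affine_form J' g"
      "\<And>x. (\<forall>g\<in>C'. 0 \<le> g x) \<longleftrightarrow> (\<exists>y. (\<forall>i. i \<notin> J \<longrightarrow> y i = x i) \<and> (\<forall>g\<in>C1. 0 \<le> g y))"
    by blast
  have "(\<exists>y. (\<forall>i. i \<notin> J \<longrightarrow> y i = x i) \<and> (\<exists>t. \<forall>f\<in>C. 0 \<le> f (y(j := t)))) \<longleftrightarrow>
        (\<exists>y. (\<forall>i. i \<notin> insert j J \<longrightarrow> y i = x i) \<and> (\<forall>f\<in>C. 0 \<le> f y))" (is "?l \<longleftrightarrow> ?r") for x
  proof
    assume ?l
    then obtain y t where "\<forall>i. i \<notin> J \<longrightarrow> y i = x i" "\<forall>f\<in>C. 0 \<le> f (y(j := t))" by blast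
    then show ?r by (intro exI[of _ "y(j := t)"]) auto
  next
    assume ?r
    then obtain y where "\<forall>i. i \<notin> insert j J \<longrightarrow> y i = x i" "\<forall>f\<in>C. 0 \<le> f y" by blast
    then show ?l by (intro exI[of _ "y(j := x j)"]) (auto intro!: exI[of _ "y j"])
  qed
  with C' C1(3) show ?case by auto
qed

section \<open>A near-optimal multiplier for the resource-sharing problem\<close>

text \<open>
  The coordinates of the joint linear program: all decision variables of all parties, together
  with two quantities to which the program is projected, namely the vector \<open>Pool\<close> of resources
  handed out in total and a \<open>Payoff\<close> that the total utility has to reach.
\<close>

datatype 'm lp_var = Plan nat nat | Share nat 'm | Pool 'm | Payoff

lemma resource_sharing_optimalD:
  assumes "resource_sharing_optimal c K D x_opt s_opt"
  shows "\<And>k. k < K \<Longrightarrow> party_feasible c (D k) (x_opt k) (s_opt k)" "(\<Sum>k<K. s_opt k) = c"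
    and "\<And>x s. \<lbrakk>\<And>k. k < K \<Longrightarrow> party_feasible c (D k) (x k) (s k); (\<Sum>k<K. s k) = c\<rbrakk> \<Longrightarrow>
      (\<Sum>k<K. utility (D k) (x k)) \<le> (\<Sum>k<K. utility (D k) (x_opt k))"
  using assms by (auto simp: resource_sharing_optimal_def is_arg_max_linorder)

lemma lagrangian_alt:
  "lagrangian c K D x s \<mu> = (\<Sum>k<K. utility (D k) (x k)) + (c - (\<Sum>k<K. s k)) \<bullet> \<mu>"
  by (simp add: lagrangian_def sum_subtractf inner_diff_left inner_sum_left)

text \<open>
  Let \<open>p\<close> be the optimal value. The attainable pairs (pool, payoff) form a projected polyhedron
  which contains \<open>(c, p)\<close> but not \<open>(c, p + e)\<close>. One of its inequalities
  \<open>0 \<le> \<alpha> + r \<bullet> \<mu> - \<beta> * \<tau>\<close> therefore holds at all attainable \<open>(r, \<tau>)\<close> and fails at \<open>(c, p + e)\<close>.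
  Comparing \<open>(c, p)\<close> with \<open>(c, p + e)\<close> shows \<open>\<beta> > 0\<close>, and after division by \<open>\<beta>\<close> the inequality
  bounds the Lagrangian by \<open>p + e\<close>. The tolerance \<open>e\<close> is harmless: the minimum of the dual is
  attained, so it suffices to come arbitrarily close to \<open>p\<close>.
\<close>

lemma near_optimal_multiplier:
  fixes c :: "real^'m::finite" and D :: "nat \<Rightarrow> 'm private_data"
  assumes opt: "resource_sharing_optimal c K D x_opt s_opt" and "0 < e"
  shows "\<exists>\<mu>. \<forall>x s. (\<forall>k<K. party_feasible c (D k) (x k) (s k)) \<longrightarrow>
           lagrangian c K D x s \<mu> \<le> (\<Sum>k<K. utility (D k) (x_opt k)) + e"
proof -
  define p where "p = (\<Sum>k<K. utility (D k) (x_opt k))"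
  \<comment> \<open>The coordinates \<open>J\<close> are eliminated, the coordinates \<open>J'\<close> are kept.\<close>
  define J :: "'m lp_var set" where
    "J = (\<Union>k<K. Plan k ` {..<num_vars (D k)}) \<union> (\<Union>k<K. range (Share k))"
  define J' :: "'m lp_var set" where "J' = insert Payoff (range Pool)"
  define V where "V = J \<union> J'"
  have fin: "finite J" "finite J'" by (auto simp: J_def J'_def)
  have "finite V" using fin by (simp add: V_def)
  have mem: "Plan k j \<in> V" if "k < K" "j < num_vars (D k)" for k j
    using that by (auto simp: V_def J_def)
  have mem': "Share k i \<in> V" if "k < K" for k i
    using that by (auto simp: V_def J_def)
  have mem'': "Pool i \<in> V" "Payoff \<in> V" for i
    by (auto simp: V_def J'_def)
  have disj: "J \<inter> J' = {}" by (auto simp: J_def J'_def)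
  define C :: "(('m lp_var \<Rightarrow> real) \<Rightarrow> real) set" where
    "C = (\<Union>k<K. \<Union>i. {\<lambda>y. y (Share k i) - (\<Sum>j<num_vars (D k). res_mat (D k) i j * y (Plan k j)),
                      \<lambda>y. y (Share k i), \<lambda>y. c $ i - y (Share k i)})
       \<union> (\<Union>k<K. \<Union>l<num_cons (D k).
            {\<lambda>y. con_rhs (D k) l - (\<Sum>j<num_vars (D k). con_mat (D k) l j * y (Plan k j))})
       \<union> (\<Union>i. {\<lambda>y. y (Pool i) - (\<Sum>k<K. y (Share k i)), \<lambda>y. (\<Sum>k<K. y (Share k i)) - y (Pool i)})
       \<union> {\<lambda>y. (\<Sum>k<K. \<Sum>j<num_vars (D k). util_vec (D k) j * y (Plan k j)) - y Payoff}"
  have C_iff: "(\<forall>f\<in>C. 0 \<le> f y) \<longleftrightarrow>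
      (\<forall>k<K. \<forall>i. (\<Sum>j<num_vars (D k). res_mat (D k) i j * y (Plan k j)) \<le> y (Share k i) \<and>
                  0 \<le> y (Share k i) \<and> y (Share k i) \<le> c $ i) \<and>
      (\<forall>k<K. \<forall>l<num_cons (D k).
         (\<Sum>j<num_vars (D k). con_mat (D k) l j * y (Plan k j)) \<le> con_rhs (D k) l) \<and>
      (\<forall>i. y (Pool i) = (\<Sum>k<K. y (Share k i))) \<and>
      y Payoff \<le> (\<Sum>k<K. \<Sum>j<num_vars (D k). util_vec (D k) j * y (Plan k j))" for y
    by (simp add: C_def ball_Un order_eq_iff)
  have "finite C" by (simp add: C_def)
  moreover have "affine_form V f" if "f \<in> C" for f
    using that \<open>finite V\<close> unfolding C_def
    by (auto intro!: affine_form_diff affine_form_sum affine_form_cmult affine_form_const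
                     affine_form_coord mem mem' mem'')
  ultimately obtain C' where C': "\<And>g. g \<in> C' \<Longrightarrow> affine_form J' g"
    "\<And>x. (\<forall>g\<in>C'. 0 \<le> g x) \<longleftrightarrow> (\<exists>y. (\<forall>j. j \<notin> J \<longrightarrow> y j = x j) \<and> (\<forall>f\<in>C. 0 \<le> f y))"
    using fourier_motzkin[OF fin disj, of C] unfolding V_def by blast
  define pt :: "real^'m \<Rightarrow> real \<Rightarrow> 'm lp_var \<Rightarrow> real" where
    "pt r \<tau> = (\<lambda>v. case v of Plan k j \<Rightarrow> 0 | Share k i \<Rightarrow> 0 | Pool i \<Rightarrow> r $ i | Payoff \<Rightarrow> \<tau>)" for r \<tau>
  have attainable: "\<forall>g\<in>C'. 0 \<le> g (pt (\<Sum>k<K. s k) (\<Sum>k<K. utility (D k) (x k)))"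
    if feas: "\<And>k. k < K \<Longrightarrow> party_feasible c (D k) (x k) (s k)" for x s
  proof -
    define y where "y = (\<lambda>v. case v of
        Plan k j \<Rightarrow> if Plan k j \<in> J then x k j else 0
      | Share k i \<Rightarrow> if Share k i \<in> J then s k $ i else 0
      | Pool i \<Rightarrow> (\<Sum>k<K. s k) $ i | Payoff \<Rightarrow> (\<Sum>k<K. utility (D k) (x k)))"
    have y: "y (Plan k j) = x k j" if "k < K" "j < num_vars (D k)" for k j
      using that by (auto simp: y_def J_def)
    have y': "y (Share k i) = s k $ i" if "k < K" for k i
      using that by (force simp: y_def J_def)
    have y'': "y (Pool i) = (\<Sum>k<K. s k $ i)" "y Payoff = (\<Sum>k<K. utility (D k) (x k))" for i
      by (simp_all add: y_def sum_component)
    have "\<forall>f\<in>C. 0 \<le> f y"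
      unfolding C_iff using feas
      by (simp add: y y' y'' party_feasible_def less_eq_vec_def utility_def)
    moreover have "\<forall>j. j \<notin> J \<longrightarrow> y j = pt (\<Sum>k<K. s k) (\<Sum>k<K. utility (D k) (x k)) j"
      by (auto simp: y_def pt_def split: lp_var.split)
    ultimately show ?thesis using C'(2) by blast
  qed
  \<comment> \<open>Otherwise some allocation of exactly \<open>c\<close> would have utility at least \<open>p + e\<close>.\<close>
  have "\<not> (\<forall>g\<in>C'. 0 \<le> g (pt c (p + e)))"
  proof
    assume "\<forall>g\<in>C'. 0 \<le> g (pt c (p + e))"
    then obtain y where y: "\<And>j. j \<notin> J \<Longrightarrow> y j = pt c (p + e) j" and "\<forall>f\<in>C. 0 \<le> f y"
      using C'(2) by blast
    note yC = this(2)[unfolded C_iff]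
    define x where "x k = restrict (\<lambda>j. y (Plan k j)) {..<num_vars (D k)}" for k
    define s :: "nat \<Rightarrow> real^'m" where "s k = (\<chi> i. y (Share k i))" for k
    have row: "(\<Sum>j<num_vars (D k). b j * x k j) = (\<Sum>j<num_vars (D k). b j * y (Plan k j))" for b k
      by (simp add: x_def)
    have feas: "party_feasible c (D k) (x k) (s k)" if "k < K" for k
      using yC that unfolding party_feasible_def row
      by (simp add: s_def less_eq_vec_def) (simp add: x_def)
    have pt: "y (Pool i) = c $ i" "y Payoff = p + e" for i
      using y[of "Pool i"] y[of Payoff] by (auto simp: J_def pt_def)
    have "(\<Sum>k<K. s k) $ i = c $ i" for i
    proof -
      have "y (Pool i) = (\<Sum>k<K. y (Share k i))" using yC by blast
      then show ?thesis unfolding pt by (simp add: s_def sum_component)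
    qed
    then have total: "(\<Sum>k<K. s k) = c" by (simp add: vec_eq_iff)
    have "p + e \<le> (\<Sum>k<K. utility (D k) (x k))"
      unfolding utility_def row pt(2)[symmetric] using yC by blast
    also have "\<dots> \<le> p"
      unfolding p_def using resource_sharing_optimalD(3)[OF opt feas total] .
    finally show False using \<open>0 < e\<close> by simp
  qed
  then obtain g where g: "g \<in> C'" "g (pt c (p + e)) < 0" by force
  obtain \<alpha> a where a: "\<And>y. g y = \<alpha> + (\<Sum>j\<in>J'. a j * y j)"
    using C'(1)[OF g(1)] unfolding affine_form_def by blast
  have sum_J': "(\<Sum>j\<in>J'. F j) = F Payoff + (\<Sum>i\<in>UNIV. F (Pool i))" for F :: "'m lp_var \<Rightarrow> real"
  proof -
    have "Payoff \<notin> range (Pool :: 'm \<Rightarrow> _)" "inj (Pool :: 'm \<Rightarrow> _)" by (auto intro: injI)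
    then show ?thesis by (simp add: J'_def sum.reindex)
  qed
  define \<beta> where "\<beta> = - a Payoff"
  define \<mu> :: "real^'m" where "\<mu> = (\<chi> i. a (Pool i))"
  have gpt: "g (pt r \<tau>) = \<alpha> + r \<bullet> \<mu> - \<beta> * \<tau>" for r \<tau>
    by (simp add: a sum_J' pt_def \<beta>_def \<mu>_def inner_vec_def mult_ac)
  note feas = resource_sharing_optimalD(1,2)[OF opt]
  have "0 \<le> \<alpha> + c \<bullet> \<mu> - \<beta> * p"
    using attainable[OF feas(1)] g(1) feas(2) gpt by (auto simp: p_def)
  moreover have neg: "\<alpha> + c \<bullet> \<mu> - \<beta> * (p + e) < 0" using g(2) gpt by simp
  ultimately have "0 < \<beta> * e" by (simp add: algebra_simps)
  then have "0 < \<beta>" using \<open>0 < e\<close> by (simp add: zero_less_mult_iff)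
  have "lagrangian c K D x s (\<mu> /\<^sub>R \<beta>) \<le> p + e"
    if "\<forall>k<K. party_feasible c (D k) (x k) (s k)" for x s
  proof -
    define U where "U = (\<Sum>k<K. utility (D k) (x k))"
    have "0 \<le> \<alpha> + (\<Sum>k<K. s k) \<bullet> \<mu> - \<beta> * U"
      using attainable[of x s] that g(1) gpt by (auto simp: U_def)
    then have "c \<bullet> \<mu> + \<beta> * U - (\<Sum>k<K. s k) \<bullet> \<mu> \<le> \<beta> * (p + e)" using neg by linarith
    then have "(c \<bullet> \<mu> + \<beta> * U - (\<Sum>k<K. s k) \<bullet> \<mu>) / \<beta> \<le> p + e"
      using \<open>0 < \<beta>\<close> by (simp add: divide_simps mult_ac)
    moreover have "lagrangian c K D x s (\<mu> /\<^sub>R \<beta>) = (c \<bullet> \<mu> + \<beta> * U - (\<Sum>k<K. s k) \<bullet> \<mu>) / \<beta>"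
      using \<open>0 < \<beta>\<close>
      by (simp add: lagrangian_alt U_def[symmetric] inner_diff_left divide_simps)
    ultimately show ?thesis by simp
  qed
  then show ?thesis unfolding p_def by blast
qed

section \<open>The dual function and strong duality\<close>

lemma argmax_selectionD:
  assumes "argmax_selection c D \<sigma>"
  shows argmax_selection_feasible: "party_feasible c D (fst (\<sigma> \<mu>)) (snd (\<sigma> \<mu>))"
    and argmax_selection_maximal: "\<And>x s. party_feasible c D x s \<Longrightarrow>
      utility D x - s \<bullet> \<mu> \<le> utility D (fst (\<sigma> \<mu>)) - snd (\<sigma> \<mu>) \<bullet> \<mu>"
  using assms unfolding argmax_selection_def subproblem_optimal_def is_arg_max_linorder
  by (auto simp: case_prod_beta)

lemma subproblem_value_eq:
  assumes "argmax_selection c D \<sigma>"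
  shows "subproblem_value c D \<mu> = utility D (fst (\<sigma> \<mu>)) - snd (\<sigma> \<mu>) \<bullet> \<mu>"
  unfolding subproblem_value_def
proof (rule cSup_eq_maximum)
  show "utility D (fst (\<sigma> \<mu>)) - snd (\<sigma> \<mu>) \<bullet> \<mu> \<in>
      (\<lambda>(x, s). utility D x - s \<bullet> \<mu>) ` {(x, s). party_feasible c D x s}"
    using argmax_selection_feasible[OF assms, of \<mu>] by force
qed (use argmax_selection_maximal[OF assms, of _ _ \<mu>] in auto)

text \<open>
  With a maximiser selected in every sub-problem, the dual function is the Lagrangian at the
  selected solutions, and the resources left over by them form a subgradient of it. The algorithm
  is therefore a subgradient method whose subgradients are perturbed by the noise.
\<close>

locale relaxed_resource_sharing =
  fixes c :: "real^'m::finite" and K :: nat and D :: "nat \<Rightarrow> 'm private_data"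
    and \<sigma> :: "nat \<Rightarrow> real^'m \<Rightarrow> (nat \<Rightarrow> real) \<times> (real^'m)"
  assumes selection: "\<And>k. k < K \<Longrightarrow> argmax_selection c (D k) (\<sigma> k)"
begin

definition dual :: "real^'m \<Rightarrow> real" where
  "dual \<mu> = lagrangian c K D (\<lambda>k. fst (\<sigma> k \<mu>)) (\<lambda>k. snd (\<sigma> k \<mu>)) \<mu>"

definition slack :: "real^'m \<Rightarrow> real^'m" where
  "slack \<mu> = c - (\<Sum>k<K. snd (\<sigma> k \<mu>))"

lemma dual_eq: "dual \<mu> = c \<bullet> \<mu> + (\<Sum>k<K. subproblem_value c (D k) \<mu>)"
  unfolding dual_def lagrangian_def using subproblem_value_eq[OF selection] by simp

lemma lagrangian_le_dual:
  assumes "\<And>k. k < K \<Longrightarrow> party_feasible c (D k) (x k) (s k)"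
  shows "lagrangian c K D x s \<mu> \<le> dual \<mu>"
  unfolding dual_def lagrangian_def
  by (intro add_left_mono sum_mono argmax_selection_maximal[OF selection] assms) auto

text \<open>
  The solutions selected at \<open>\<mu>\<close> stay feasible in the sub-problems at \<open>\<mu>'\<close>, and the Lagrangian at
  fixed solutions is affine in the multiplier with slope \<open>slack \<mu>\<close>.
\<close>

lemma dual_subgradient: "dual \<mu> + slack \<mu> \<bullet> (\<mu>' - \<mu>) \<le> dual \<mu>'"
proof -
  have "lagrangian c K D (\<lambda>k. fst (\<sigma> k \<mu>)) (\<lambda>k. snd (\<sigma> k \<mu>)) \<mu>' \<le> dual \<mu>'"
    by (intro lagrangian_le_dual argmax_selection_feasible selection)
  then show ?thesis
    by (simp add: dual_def lagrangian_alt slack_def inner_diff_right)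
qed

text \<open>
  The attained dual minimum lies below the dual value at every near-optimal multiplier, hence
  below the primal optimum. The other inequality is weak duality.
\<close>

lemma strong_duality:
  assumes "resource_sharing_optimal c K D x_opt s_opt" "dual_optimal c K D mu_opt"
  shows "dual mu_opt = lagrangian c K D x_opt s_opt mu_opt"
proof (rule antisym)
  have "dual mu_opt \<le> (\<Sum>k<K. utility (D k) (x_opt k)) + e" if "0 < e" for e
  proof -
    obtain \<mu> where \<mu>: "\<forall>x s. (\<forall>k<K. party_feasible c (D k) (x k) (s k)) \<longrightarrow>
        lagrangian c K D x s \<mu> \<le> (\<Sum>k<K. utility (D k) (x_opt k)) + e"
      using near_optimal_multiplier[OF assms(1) \<open>0 < e\<close>] by blast
    have "dual \<mu> \<le> (\<Sum>k<K. utility (D k) (x_opt k)) + e"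
      unfolding dual_def
      by (rule \<mu>[rule_format]) (rule argmax_selection_feasible[OF selection])
    moreover have "dual mu_opt \<le> dual \<mu>"
      using assms(2) unfolding dual_optimal_def is_arg_min_linorder dual_eq by simp
    ultimately show ?thesis by simp
  qed
  then have "dual mu_opt \<le> (\<Sum>k<K. utility (D k) (x_opt k))" by (rule field_le_epsilon)
  then show "dual mu_opt \<le> lagrangian c K D x_opt s_opt mu_opt"
    using resource_sharing_optimalD(2)[OF assms(1)] by (simp add: lagrangian_alt)
  show "lagrangian c K D x_opt s_opt mu_opt \<le> dual mu_opt"
    by (intro lagrangian_le_dual resource_sharing_optimalD(1)[OF assms(1)])
qed

text \<open>
  Every share lies between \<open>0\<close> and \<open>c\<close>, so \<open>slack \<mu>\<close> lies between \<open>- (K - 1) c\<close> and \<open>c\<close>. For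
  \<open>K \<ge> 2\<close> the first of these bounds dominates in absolute value, which is the origin of the
  factor \<open>K - 1\<close>.
\<close>

lemma norm_slack_le:
  assumes "1 < K"
  shows "norm (slack \<mu>) \<le> (real K - 1) * norm c"
proof -
  have share: "0 \<le> snd (\<sigma> k \<mu>) $ i" "snd (\<sigma> k \<mu>) $ i \<le> c $ i" if "k < K" for k i
    using argmax_selection_feasible[OF selection[OF that], of \<mu>]
    by (auto simp: party_feasible_def less_eq_vec_def)
  have "norm (slack \<mu>) \<le> norm ((real K - 1) *\<^sub>R c)"
  proof (rule norm_le_componentwise_cart)
    fix i
    have "0 \<le> (\<Sum>k<K. snd (\<sigma> k \<mu>) $ i)" "(\<Sum>k<K. snd (\<sigma> k \<mu>) $ i) \<le> real K * c $ i"
      using share sum_bounded_above[of "{..<K}" "\<lambda>k. snd (\<sigma> k \<mu>) $ i" "c $ i"]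
      by (auto intro!: sum_nonneg)
    moreover have "0 \<le> c $ i" using share[of 0 i] assms by force
    then have "c $ i \<le> (real K - 1) * c $ i"
      using assms mult_right_mono[of 1 "real K - 1" "c $ i"] by simp
    ultimately show "norm (slack \<mu> $ i) \<le> norm (((real K - 1) *\<^sub>R c) $ i)"
      using \<open>0 \<le> c $ i\<close> by (simp add: slack_def sum_component algebra_simps abs_le_iff)
  qed
  then show ?thesis using assms by simp
qed

lemma measurable_selection:
  assumes "k < K"
  shows "\<sigma> k \<in> borel \<rightarrow>\<^sub>M Pi\<^sub>M {..<num_vars (D k)} (\<lambda>_. borel) \<Otimes>\<^sub>M borel"
  using selection[OF assms] unfolding argmax_selection_def by blast

lemma measurable_share:
  assumes "k < K"
  shows "(\<lambda>\<mu>. snd (\<sigma> k \<mu>)) \<in> borel_measurable borel"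
  by (rule measurable_compose[OF measurable_selection[OF assms] measurable_snd])

lemma measurable_utility:
  assumes "k < K"
  shows "(\<lambda>\<mu>. utility (D k) (fst (\<sigma> k \<mu>))) \<in> borel_measurable borel"
proof -
  have "(\<lambda>\<mu>. fst (\<sigma> k \<mu>) j) \<in> borel_measurable borel" if "j < num_vars (D k)" for j
    by (rule measurable_compose[OF measurable_compose[OF measurable_selection[OF assms] measurable_fst]
          measurable_component_singleton]) (use that in simp)
  then show ?thesis unfolding utility_def
    by (intro borel_measurable_sum borel_measurable_times) auto
qed

lemma measurable_slack: "slack \<in> borel_measurable borel"
proof -
  have "(\<lambda>\<mu>. c - (\<Sum>k<K. snd (\<sigma> k \<mu>))) \<in> borel_measurable borel"
    by (intro borel_measurable_diff borel_measurable_const borel_measurable_sum measurable_share) simp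
  then show ?thesis by (simp add: slack_def[abs_def])
qed

lemma measurable_dual: "dual \<in> borel_measurable borel"
proof -
  have "(\<lambda>\<mu>. (\<Sum>k<K. utility (D k) (fst (\<sigma> k \<mu>))) + slack \<mu> \<bullet> \<mu>) \<in> borel_measurable borel"
    by (intro borel_measurable_add borel_measurable_sum borel_measurable_inner
          measurable_utility measurable_slack measurable_ident_sets) simp_all
  then show ?thesis by (simp add: dual_def[abs_def] lagrangian_alt slack_def)
qed

end

section \<open>Subgradient descent with centred independent noise\<close>

lemma (in prob_space) expectation_inner_indep_zero_mean:
  fixes X Y :: "'a \<Rightarrow> 'v::euclidean_space"
  assumes indep: "indep_var borel X borel Y"
    and int: "integrable M X" "integrable M Y" and mean: "expectation Y = 0"
  shows "integrable M (\<lambda>z. X z \<bullet> Y z)" "expectation (\<lambda>z. X z \<bullet> Y z) = 0"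
proof -
  have indep_b: "indep_var borel (\<lambda>z. X z \<bullet> b) borel (\<lambda>z. Y z \<bullet> b)" for b
    using indep_var_compose[OF indep, of "\<lambda>x. x \<bullet> b" borel "\<lambda>y. y \<bullet> b" borel] by (simp add: comp_def)
  have mean_b: "expectation (\<lambda>z. Y z \<bullet> b) = 0" for b
    using int(2) mean by (simp add: integral_inner_left)
  have *: "X z \<bullet> Y z = (\<Sum>b\<in>Basis. (X z \<bullet> b) * (Y z \<bullet> b))" for z
    by (rule euclidean_inner)
  have int_b: "integrable M (\<lambda>z. X z \<bullet> b)" "integrable M (\<lambda>z. Y z \<bullet> b)" for b
    using int by auto
  have prod: "integrable M (\<lambda>z. (X z \<bullet> b) * (Y z \<bullet> b))" "expectation (\<lambda>z. (X z \<bullet> b) * (Y z \<bullet> b)) = 0" for b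
    using indep_var_integrable[OF indep_b int_b] indep_var_lebesgue_integral[OF indep_b int_b] mean_b
    by simp_all
  show "integrable M (\<lambda>z. X z \<bullet> Y z)" "expectation (\<lambda>z. X z \<bullet> Y z) = 0"
    unfolding * using prod by (simp_all add: integral_sum integrable_sum)
qed

lemma (in prob_space) integrable_of_integrable_norm_square:
  fixes X :: "'a \<Rightarrow> 'v::euclidean_space"
  assumes "X \<in> borel_measurable M" "integrable M (\<lambda>z. (norm (X z))\<^sup>2)"
  shows "integrable M X"
proof -
  have bound: "norm (X z) \<le> 1 + (norm (X z))\<^sup>2" for z
    using sum_squares_bound[of 1 "norm (X z)"] norm_ge_zero[of "X z"] unfolding power_one by linarith
  show ?thesis
  proof (rule Bochner_Integration.integrable_bound)
    show "integrable M (\<lambda>z. 1 + (norm (X z))\<^sup>2)" using assms(2) by simp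
    show "AE z in M. norm (X z) \<le> norm (1 + (norm (X z))\<^sup>2)"
      using order_trans[OF bound abs_ge_self] by (intro AE_I2) simp
  qed (rule assms(1))
qed

text \<open>
  The classical energy argument. Expanding the square,
  \<open>|l (t+1) - x_opt|\<^sup>2 = |l t - x_opt|\<^sup>2 - 2\<nu> g \<bullet> (l t - x_opt) + \<nu>\<^sup>2 |g|\<^sup>2 + \<nu>\<^sup>2 |\<xi> t|\<^sup>2 + h (l t) \<bullet> \<xi> t\<close>
  for a function \<open>h\<close> of the iterate alone. The last term vanishes in expectation because the noise
  is centred and independent of the iterate, and the second one is at most \<open>- 2\<nu> F (l t)\<close> by the
  subgradient inequality. Summing over \<open>t\<close> telescopes. Integrability comes along: \<open>F (l t)\<close> lies
  between \<open>0\<close> and \<open>R |l t - x_opt|\<close>.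
\<close>

lemma (in prob_space) noisy_subgradient_descent:
  fixes F :: "'v::euclidean_space \<Rightarrow> real" and g :: "'v \<Rightarrow> 'v"
    and l \<xi> :: "nat \<Rightarrow> 'a \<Rightarrow> 'v"
  assumes F: "F \<in> borel_measurable borel" "\<And>x. 0 \<le> F x" "\<And>x. F x \<le> g x \<bullet> (x - x_opt)"
    and g: "g \<in> borel_measurable borel" "\<And>x. norm (g x) \<le> R"
    and l: "\<And>z. l 0 z = x0" "\<And>t z. t < T \<Longrightarrow> l (Suc t) z = l t z - \<nu> *\<^sub>R (g (l t z) - \<xi> t z)"
    and \<xi>: "\<And>t. t < T \<Longrightarrow> indep_var borel (l t) borel (\<xi> t)"
      "\<And>t. t < T \<Longrightarrow> expectation (\<xi> t) = 0"
      "\<And>t. t < T \<Longrightarrow> integrable M (\<lambda>z. (norm (\<xi> t z))\<^sup>2)"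
      "\<And>t. t < T \<Longrightarrow> expectation (\<lambda>z. (norm (\<xi> t z))\<^sup>2) \<le> V"
    and "0 < \<nu>"
  shows "\<And>t. t \<le> T \<Longrightarrow> integrable M (\<lambda>z. F (l t z))"
    and "2 * \<nu> * (\<Sum>t<T. expectation (\<lambda>z. F (l t z))) \<le> (norm (x0 - x_opt))\<^sup>2 + real T * (\<nu>\<^sup>2 * (R\<^sup>2 + V))"
proof -
  have "0 \<le> R" using g(2)[of 0] norm_ge_zero order_trans by blast
  have rv_\<xi>: "\<xi> t \<in> borel_measurable M" and rv_l: "l t \<in> borel_measurable M" if "t < T" for t
    using indep_var_rv1[OF \<xi>(1)[OF that]] indep_var_rv2[OF \<xi>(1)[OF that]] by auto
  have int_\<xi>: "integrable M (\<xi> t)" if "t < T" for t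
    by (rule integrable_of_integrable_norm_square[OF rv_\<xi>[OF that] \<xi>(3)[OF that]])
  have g_l: "(\<lambda>z. g (l t z)) \<in> borel_measurable M" if "l t \<in> borel_measurable M" for t
    using measurable_compose[OF that g(1)] .
  have bounded: "integrable M (\<lambda>z. g (l t z))" if "l t \<in> borel_measurable M" for t
    by (rule integrable_const_bound[of _ R]) (use g(2) g_l[OF that] in auto)
  have step: "(norm (l (Suc t) z - x_opt))\<^sup>2 = (norm (l t z - x_opt))\<^sup>2
      - 2 * \<nu> * (g (l t z) \<bullet> (l t z - x_opt)) + \<nu>\<^sup>2 * (norm (g (l t z)))\<^sup>2 + \<nu>\<^sup>2 * (norm (\<xi> t z))\<^sup>2
      + ((2 * \<nu>) *\<^sub>R (l t z - x_opt) - (2 * \<nu>\<^sup>2) *\<^sub>R g (l t z)) \<bullet> \<xi> t z" if "t < T" for t z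
    unfolding l(2)[OF that] power2_norm_eq_inner
    by (simp add: inner_simps inner_commute power2_eq_square algebra_simps)
  have cross: "integrable M (\<lambda>z. ((2 * \<nu>) *\<^sub>R (l t z - x_opt) - (2 * \<nu>\<^sup>2) *\<^sub>R g (l t z)) \<bullet> \<xi> t z)"
    "expectation (\<lambda>z. ((2 * \<nu>) *\<^sub>R (l t z - x_opt) - (2 * \<nu>\<^sup>2) *\<^sub>R g (l t z)) \<bullet> \<xi> t z) = 0"
    if "t < T" "integrable M (l t)" for t
  proof -
    define h where "h x = (2 * \<nu>) *\<^sub>R (x - x_opt) - (2 * \<nu>\<^sup>2) *\<^sub>R g x" for x
    have "h \<in> borel_measurable borel" unfolding h_def using g(1) by measurable
    then have "indep_var borel (\<lambda>z. h (l t z)) borel (\<xi> t)"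
      using indep_var_compose[OF \<xi>(1)[OF that(1)], of h borel "\<lambda>x. x" borel] by (simp add: comp_def)
    moreover have "integrable M (\<lambda>z. h (l t z))"
      unfolding h_def using that bounded[OF rv_l] by (intro Bochner_Integration.integrable_diff integrable_scaleR_right) auto
    ultimately show "integrable M (\<lambda>z. ((2 * \<nu>) *\<^sub>R (l t z - x_opt) - (2 * \<nu>\<^sup>2) *\<^sub>R g (l t z)) \<bullet> \<xi> t z)"
      "expectation (\<lambda>z. ((2 * \<nu>) *\<^sub>R (l t z - x_opt) - (2 * \<nu>\<^sup>2) *\<^sub>R g (l t z)) \<bullet> \<xi> t z) = 0"
      using expectation_inner_indep_zero_mean[OF _ _ int_\<xi>[OF that(1)] \<xi>(2)[OF that(1)]]
      unfolding h_def by blast+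
  qed
  have int_g_sq: "integrable M (\<lambda>z. (norm (g (l t z)))\<^sup>2)" if "l t \<in> borel_measurable M" for t
    by (rule integrable_const_bound[of _ "R\<^sup>2"]) (use g_l[OF that] in \<open>auto intro!: power_mono g(2)\<close>)
  have int_l: "integrable M (l t)" if "t \<le> T" for t
    using that
  proof (induction t)
    case 0
    have "l 0 = (\<lambda>_. x0)" using l(1) by blast
    then show ?case by simp
  next
    case (Suc t)
    then have "integrable M (\<lambda>z. l t z - \<nu> *\<^sub>R (g (l t z) - \<xi> t z))"
      using bounded[OF rv_l[of t]] int_\<xi>[of t]
      by (intro Bochner_Integration.integrable_diff integrable_scaleR_right) auto
    moreover have "l (Suc t) = (\<lambda>z. l t z - \<nu> *\<^sub>R (g (l t z) - \<xi> t z))"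
      using l(2)[of t] Suc.prems by auto
    ultimately show ?case by simp
  qed
  have int_drift: "integrable M (\<lambda>z. g (l t z) \<bullet> (l t z - x_opt))" if "t \<le> T" for t
  proof (rule Bochner_Integration.integrable_bound)
    show "integrable M (\<lambda>z. R * norm (l t z - x_opt))" using int_l[OF that] by auto
    show "(\<lambda>z. g (l t z) \<bullet> (l t z - x_opt)) \<in> borel_measurable M"
      using g_l int_l[OF that] by (auto intro!: borel_measurable_inner)
    have "norm (g (l t z) \<bullet> (l t z - x_opt)) \<le> norm (R * norm (l t z - x_opt))" for z
    proof -
      have "\<bar>g (l t z) \<bullet> (l t z - x_opt)\<bar> \<le> norm (g (l t z)) * norm (l t z - x_opt)"
        by (rule Cauchy_Schwarz_ineq2)
      also have "\<dots> \<le> R * norm (l t z - x_opt)" by (intro mult_right_mono g(2)) simp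
      also have "\<dots> \<le> norm (R * norm (l t z - x_opt))" unfolding real_norm_def by (rule abs_ge_self)
      finally show ?thesis unfolding real_norm_def .
    qed
    then show "AE z in M. norm (g (l t z) \<bullet> (l t z - x_opt)) \<le> norm (R * norm (l t z - x_opt))"
      by (rule AE_I2)
  qed
  show int_F: "integrable M (\<lambda>z. F (l t z))" if "t \<le> T" for t
  proof (rule Bochner_Integration.integrable_bound[OF int_drift[OF that]])
    show "(\<lambda>z. F (l t z)) \<in> borel_measurable M"
      by (rule measurable_compose[OF borel_measurable_integrable[OF int_l[OF that]] F(1)])
    show "AE z in M. norm (F (l t z)) \<le> norm (g (l t z) \<bullet> (l t z - x_opt))"
      using F(2) order_trans[OF F(3) abs_ge_self] by (intro AE_I2) simp
  qed
  have dist: "integrable M (\<lambda>z. (norm (l t z - x_opt))\<^sup>2) \<and>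
      expectation (\<lambda>z. (norm (l t z - x_opt))\<^sup>2) + 2 * \<nu> * (\<Sum>i<t. expectation (\<lambda>z. F (l i z)))
        \<le> (norm (x0 - x_opt))\<^sup>2 + real t * (\<nu>\<^sup>2 * (R\<^sup>2 + V))" if "t \<le> T" for t
    using that
  proof (induction t)
    case 0
    then show ?case by (simp add: l(1) prob_space)
  next
    case (Suc t)
    then have t: "t < T" "t \<le> T" by auto
    note int = int_drift[OF t(2)] int_g_sq[OF rv_l[OF t(1)]] \<xi>(3)[OF t(1)] cross[OF t(1) int_l[OF t(2)]]
      Suc.IH[OF t(2), THEN conjunct1]
    have "expectation (\<lambda>z. F (l t z)) \<le> expectation (\<lambda>z. g (l t z) \<bullet> (l t z - x_opt))"
      by (rule integral_mono[OF int_F[OF t(2)] int(1)]) (rule F(3))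
    then have drift: "2 * \<nu> * expectation (\<lambda>z. F (l t z)) \<le> 2 * \<nu> * expectation (\<lambda>z. g (l t z) \<bullet> (l t z - x_opt))"
      using \<open>0 < \<nu>\<close> by simp
    have "expectation (\<lambda>z. (norm (g (l t z)))\<^sup>2) \<le> expectation (\<lambda>z. R\<^sup>2)"
      by (rule integral_mono[OF int(2)]) (auto intro!: power_mono g(2))
    then have "\<nu>\<^sup>2 * expectation (\<lambda>z. (norm (g (l t z)))\<^sup>2) + \<nu>\<^sup>2 * expectation (\<lambda>z. (norm (\<xi> t z))\<^sup>2)
        \<le> \<nu>\<^sup>2 * (R\<^sup>2 + V)"
      using \<xi>(4)[OF t(1)] unfolding distrib_left[symmetric]
      by (intro mult_left_mono add_mono) (auto simp: prob_space)
    moreover have "expectation (\<lambda>z. (norm (l (Suc t) z - x_opt))\<^sup>2) =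
        expectation (\<lambda>z. (norm (l t z - x_opt))\<^sup>2)
        - 2 * \<nu> * expectation (\<lambda>z. g (l t z) \<bullet> (l t z - x_opt))
        + \<nu>\<^sup>2 * expectation (\<lambda>z. (norm (g (l t z)))\<^sup>2) + \<nu>\<^sup>2 * expectation (\<lambda>z. (norm (\<xi> t z))\<^sup>2)"
      unfolding step[OF t(1)] using int by simp
    moreover have "integrable M (\<lambda>z. (norm (l (Suc t) z - x_opt))\<^sup>2)"
      unfolding step[OF t(1)] using int by auto
    ultimately show ?case
      using Suc.IH[OF t(2)] drift by (simp add: algebra_simps)
  qed
  have "0 \<le> expectation (\<lambda>z. (norm (l T z - x_opt))\<^sup>2)" by simp
  then show "2 * \<nu> * (\<Sum>t<T. expectation (\<lambda>z. F (l t z)))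
      \<le> (norm (x0 - x_opt))\<^sup>2 + real T * (\<nu>\<^sup>2 * (R\<^sup>2 + V))"
    using dist[of T] by linarith
qed

section \<open>The iterates as a random process\<close>

lemma borel_measurable_vec_lambda:
  assumes "\<And>i. (\<lambda>z. f z i) \<in> borel_measurable N"
  shows "(\<lambda>z. (\<chi> i. f z i) :: real^'m::finite) \<in> borel_measurable N"
proof (subst borel_measurable_euclidean_space, rule ballI)
  fix b :: "real^'m" assume "b \<in> Basis"
  then obtain i where "b = axis i 1" by (auto simp: Basis_vec_def)
  then have "(\<lambda>z. (\<chi> i. f z i) \<bullet> b) = (\<lambda>z. f z i)" by (simp add: inner_axis)
  then show "(\<lambda>z. (\<chi> i. f z i) \<bullet> b) \<in> borel_measurable N" using assms by simp
qed

context relaxed_resource_sharing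
begin

lemma multiplier_Suc:
  "multiplier c K \<sigma> \<nu> w (Suc t) = multiplier c K \<sigma> \<nu> w t
     - \<nu> t *\<^sub>R (slack (multiplier c K \<sigma> \<nu> w t) - (\<Sum>k<K. w t k))"
  by (simp add: slack_def sum.distrib diff_diff_eq)

lemma multiplier_cong:
  assumes "\<And>i k. i < t \<Longrightarrow> k < K \<Longrightarrow> w i k = w' i k"
  shows "multiplier c K \<sigma> \<nu> w t = multiplier c K \<sigma> \<nu> w' t"
  using assms
proof (induction t)
  case (Suc t)
  have "(\<Sum>k<K. w t k) = (\<Sum>k<K. w' t k)" using Suc.prems by simp
  then show ?case using Suc.IH Suc.prems unfolding multiplier_Suc by simp
qed simp

lemma optimality_gap_eq:
  "optimality_gap c K D \<sigma> x_opt s_opt mu_opt \<nu> w t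
     = dual (multiplier c K \<sigma> \<nu> w t) - lagrangian c K D x_opt s_opt mu_opt"
  by (simp add: optimality_gap_def dual_def Let_def)

lemma measurable_noise_sum:
  assumes "{t} \<times> {..<K} \<times> UNIV \<subseteq> A"
  shows "(\<lambda>r. \<Sum>k<K. \<chi> j. r (t, k, j)) \<in> Pi\<^sub>M A (\<lambda>_. borel) \<rightarrow>\<^sub>M (borel :: (real^'m) measure)"
proof (intro borel_measurable_sum borel_measurable_vec_lambda)
  fix k j assume "k \<in> {..<K}"
  then show "(\<lambda>r. r (t, k, j)) \<in> borel_measurable (Pi\<^sub>M A (\<lambda>_. borel))"
    using assms by (intro measurable_component_singleton) auto
qed

text \<open>
  The iterate at time \<open>t\<close> is a measurable function of the noise before time \<open>t\<close>, the noise being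
  regarded as a family indexed by time, party and resource. Stating this on every index set \<open>A\<close>
  that contains the past lets the induction keep \<open>A\<close> fixed.
\<close>

lemma measurable_multiplier:
  assumes "{..<t} \<times> {..<K} \<times> UNIV \<subseteq> A"
  shows "(\<lambda>r. multiplier c K \<sigma> \<nu> (\<lambda>i k. \<chi> j. r (i, k, j)) t) \<in>
           Pi\<^sub>M A (\<lambda>_. borel) \<rightarrow>\<^sub>M (borel :: (real^'m) measure)"
  using assms
proof (induction t)
  case (Suc t)
  have l: "(\<lambda>r. multiplier c K \<sigma> \<nu> (\<lambda>i k. \<chi> j. r (i, k, j)) t) \<in>
      borel_measurable (Pi\<^sub>M A (\<lambda>_. borel))"
    using Suc.prems by (intro Suc.IH) force
  have "(\<lambda>r. \<Sum>k<K. \<chi> j. r (t, k, j)) \<in> Pi\<^sub>M A (\<lambda>_. borel) \<rightarrow>\<^sub>M (borel :: (real^'m) measure)"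
    using Suc.prems by (intro measurable_noise_sum) force
  then show ?case unfolding multiplier_Suc
    by (intro borel_measurable_diff borel_measurable_scaleR borel_measurable_const l
          measurable_compose[OF l measurable_slack])
qed simp

text \<open>
  The past and the present noise are disjoint groups of an independent family, so functions of
  one are independent of functions of the other.
\<close>

lemma indep_multiplier_noise:
  assumes "prob_space P"
    and "prob_space.indep_vars P (\<lambda>_. borel) (\<lambda>(t, k, j) z. \<omega> t k z $ j) ({..<T} \<times> {..<K} \<times> UNIV)"
    and "t < T"
  shows "prob_space.indep_var P borel (\<lambda>z. multiplier c K \<sigma> \<nu> (\<lambda>i k. \<omega> i k z) t)
           borel (\<lambda>z. \<Sum>k<K. \<omega> t k z)"
proof -
  interpret prob_space P by fact
  define A :: "(nat \<times> nat \<times> 'm) set" where "A = {..<t} \<times> {..<K} \<times> UNIV"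
  define B :: "(nat \<times> nat \<times> 'm) set" where "B = {t} \<times> {..<K} \<times> UNIV"
  let ?X = "\<lambda>(t, k, j) z. \<omega> t k z $ j"
  have AB: "A \<inter> B = {}" "A \<subseteq> {..<T} \<times> {..<K} \<times> UNIV" "B \<subseteq> {..<T} \<times> {..<K} \<times> UNIV"
    using assms(3) by (auto simp: A_def B_def)
  have "indep_var borel ((\<lambda>r. multiplier c K \<sigma> \<nu> (\<lambda>i k. \<chi> j. r (i, k, j)) t) \<circ> (\<lambda>z. \<lambda>i\<in>A. ?X i z))
      borel ((\<lambda>r. \<Sum>k<K. \<chi> j. r (t, k, j)) \<circ> (\<lambda>z. \<lambda>i\<in>B. ?X i z))"
    by (rule indep_var_compose[OF indep_var_restrict[OF assms(2) AB]])
       (auto intro!: measurable_multiplier measurable_noise_sum simp: A_def B_def)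
  also have "(\<lambda>r. multiplier c K \<sigma> \<nu> (\<lambda>i k. \<chi> j. r (i, k, j)) t) \<circ> (\<lambda>z. \<lambda>i\<in>A. ?X i z)
      = (\<lambda>z. multiplier c K \<sigma> \<nu> (\<lambda>i k. \<omega> i k z) t)"
    unfolding comp_def by (intro ext multiplier_cong) (simp add: A_def vec_eq_iff)
  also have "(\<lambda>r. \<Sum>k<K. \<chi> j. r (t, k, j)) \<circ> (\<lambda>z. \<lambda>i\<in>B. ?X i z) = (\<lambda>z. \<Sum>k<K. \<omega> t k z)"
    by (intro ext) (auto simp: B_def vec_eq_iff sum_component)
  finally show ?thesis .
qed

end

section \<open>Moments of the noise\<close>

lemma gaussian_moments:
  assumes "0 \<le> v"
  shows "integrable (gaussian 0 v) (\<lambda>x. x)" "(\<integral>x. x \<partial>gaussian 0 v) = 0"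
    "integrable (gaussian 0 v) (\<lambda>x. x\<^sup>2)" "(\<integral>x. x\<^sup>2 \<partial>gaussian 0 v) = v"
proof -
  have "integrable (gaussian 0 v) (\<lambda>x. x) \<and> (\<integral>x. x \<partial>gaussian 0 v) = 0 \<and>
    integrable (gaussian 0 v) (\<lambda>x. x\<^sup>2) \<and> (\<integral>x. x\<^sup>2 \<partial>gaussian 0 v) = v"
  proof (cases "v = 0")
    case True
    then show ?thesis
      by (simp add: gaussian_def integral_return integrable_iff_bounded nn_integral_return)
  next
    case False
    then have pos: "0 < sqrt v" using assms by simp
    then show ?thesis
      using False assms integrable_normal_moment[OF pos, of 0 1] integrable_normal_moment[OF pos, of 0 2]
        integral_normal_moment_nz_1[OF pos, of 0] integral_normal_moment_even[OF pos, of 0 1]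
      by (simp add: gaussian_def integrable_real_density integral_real_density)
  qed
  then show "integrable (gaussian 0 v) (\<lambda>x. x)" "(\<integral>x. x \<partial>gaussian 0 v) = 0"
    "integrable (gaussian 0 v) (\<lambda>x. x\<^sup>2)" "(\<integral>x. x\<^sup>2 \<partial>gaussian 0 v) = v" by blast+
qed

lemma (in prob_space) gaussian_distr_moments:
  assumes "X \<in> borel_measurable M" "distr M borel X = gaussian 0 v" "0 \<le> v"
  shows "integrable M X" "expectation X = 0"
    "integrable M (\<lambda>z. (X z)\<^sup>2)" "expectation (\<lambda>z. (X z)\<^sup>2) = v"
proof -
  have sq: "(\<lambda>x::real. x\<^sup>2) \<in> borel_measurable borel" by measurable
  have id: "(\<lambda>x::real. x) \<in> borel_measurable borel" by measurable
  show "integrable M X" "expectation X = 0" "integrable M (\<lambda>z. (X z)\<^sup>2)" "expectation (\<lambda>z. (X z)\<^sup>2) = v"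
    using gaussian_moments[OF assms(3)] integrable_distr_eq[OF assms(1) sq] integrable_distr_eq[OF assms(1) id]
      integral_distr[OF assms(1) sq] integral_distr[OF assms(1) id] unfolding assms(2) by simp_all
qed

text \<open>Centred independent variables are orthogonal, so the mixed products drop out.\<close>

lemma (in prob_space) expectation_square_sum_indep:
  fixes X :: "'i \<Rightarrow> 'a \<Rightarrow> real"
  assumes "finite I" "indep_vars (\<lambda>_. borel) X I"
    and int: "\<And>i. i \<in> I \<Longrightarrow> integrable M (X i)" "\<And>i. i \<in> I \<Longrightarrow> integrable M (\<lambda>z. (X i z)\<^sup>2)"
    and mean: "\<And>i. i \<in> I \<Longrightarrow> expectation (X i) = 0"
  shows "integrable M (\<lambda>z. (\<Sum>i\<in>I. X i z)\<^sup>2)"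
    "expectation (\<lambda>z. (\<Sum>i\<in>I. X i z)\<^sup>2) = (\<Sum>i\<in>I. expectation (\<lambda>z. (X i z)\<^sup>2))"
proof -
  have prod: "integrable M (\<lambda>z. X i z * X j z) \<and>
      expectation (\<lambda>z. X i z * X j z) = (if i = j then expectation (\<lambda>z. (X i z)\<^sup>2) else 0)"
    if "i \<in> I" "j \<in> I" for i j
  proof (cases "i = j")
    case True
    then show ?thesis using int(2)[OF that(1)] by (simp add: power2_eq_square)
  next
    case False
    have "indep_var borel ((\<lambda>r. r i) \<circ> (\<lambda>z. \<lambda>i\<in>{i}. X i z)) borel ((\<lambda>r. r j) \<circ> (\<lambda>z. \<lambda>i\<in>{j}. X i z))"
      by (rule indep_var_compose[OF indep_var_restrict[OF assms(2)]])
         (use False that in \<open>auto intro!: measurable_component_singleton\<close>)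
    then have "indep_var borel (X i) borel (X j)" by (simp add: comp_def)
    from indep_var_integrable[OF this int(1)[OF that(1)] int(1)[OF that(2)]]
      indep_var_lebesgue_integral[OF this int(1)[OF that(1)] int(1)[OF that(2)]]
    show ?thesis using False mean that by simp
  qed
  have sq: "(\<Sum>i\<in>I. X i z)\<^sup>2 = (\<Sum>i\<in>I. \<Sum>j\<in>I. X i z * X j z)" for z
    by (simp add: power2_eq_square sum_product)
  show "integrable M (\<lambda>z. (\<Sum>i\<in>I. X i z)\<^sup>2)"
    unfolding sq using prod by (intro Bochner_Integration.integrable_sum) blast
  have "expectation (\<lambda>z. (\<Sum>i\<in>I. X i z)\<^sup>2) = (\<Sum>i\<in>I. expectation (\<lambda>z. \<Sum>j\<in>I. X i z * X j z))"
    unfolding sq using prod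
    by (intro Bochner_Integration.integral_sum Bochner_Integration.integrable_sum) blast
  also have "\<dots> = (\<Sum>i\<in>I. \<Sum>j\<in>I. expectation (\<lambda>z. X i z * X j z))"
    using prod by (intro sum.cong refl Bochner_Integration.integral_sum) blast
  also have "\<dots> = (\<Sum>i\<in>I. \<Sum>j\<in>I. if i = j then expectation (\<lambda>z. (X i z)\<^sup>2) else 0)"
    using prod by (intro sum.cong refl) blast
  finally show "expectation (\<lambda>z. (\<Sum>i\<in>I. X i z)\<^sup>2) = (\<Sum>i\<in>I. expectation (\<lambda>z. (X i z)\<^sup>2))"
    using assms(1) by simp
qed

text \<open>Variances add up over the parties and, through the Euclidean norm, over the resources.\<close>

lemma (in prob_space) gaussian_noise_sum_moments:
  fixes \<omega> :: "nat \<Rightarrow> nat \<Rightarrow> 'a \<Rightarrow> real^'m::finite"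
  assumes indep: "indep_vars (\<lambda>_. borel) (\<lambda>(t, k, j) z. \<omega> t k z $ j) ({..<T} \<times> {..<K} \<times> UNIV)"
    and distr: "\<And>k j. k < K \<Longrightarrow> distr M borel (\<lambda>z. \<omega> t k z $ j) = gaussian 0 (v j)"
    and v: "\<And>j. 0 \<le> v j" and "t < T"
  shows "expectation (\<lambda>z. \<Sum>k<K. \<omega> t k z) = 0"
    "integrable M (\<lambda>z. (norm (\<Sum>k<K. \<omega> t k z))\<^sup>2)"
    "expectation (\<lambda>z. (norm (\<Sum>k<K. \<omega> t k z))\<^sup>2) = real K * (\<Sum>j\<in>UNIV. v j)"
proof -
  have rv: "(\<lambda>z. \<omega> t k z $ j) \<in> borel_measurable M" if "k < K" for k j
    using indep \<open>t < T\<close> that by (auto simp: indep_vars_def2)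
  note moments = gaussian_distr_moments[OF rv distr v]
  have coord: "integrable M (\<lambda>z. (\<Sum>k<K. \<omega> t k z $ j)\<^sup>2)"
    "expectation (\<lambda>z. (\<Sum>k<K. \<omega> t k z $ j)\<^sup>2) = real K * v j" for j
  proof -
    \<comment> \<open>The components of resource \<open>j\<close> at time \<open>t\<close> form a subfamily indexed by the parties.\<close>
    define I where "I = (\<lambda>k. (t, k, j)) ` {..<K}"
    have inj: "inj_on (\<lambda>k. (t, k, j)) {..<K}" by (auto intro: inj_onI)
    have "indep_vars (\<lambda>_. borel) (\<lambda>(t, k, j) z. \<omega> t k z $ j) I"
      using \<open>t < T\<close> by (intro indep_vars_subset[OF indep]) (auto simp: I_def)
    note * = expectation_square_sum_indep[OF _ this]
    have "integrable M (\<lambda>z. (\<Sum>i\<in>I. (case i of (t, k, j) \<Rightarrow> \<lambda>z. \<omega> t k z $ j) z)\<^sup>2)"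
      "expectation (\<lambda>z. (\<Sum>i\<in>I. (case i of (t, k, j) \<Rightarrow> \<lambda>z. \<omega> t k z $ j) z)\<^sup>2)
        = (\<Sum>i\<in>I. expectation (\<lambda>z. ((case i of (t, k, j) \<Rightarrow> \<lambda>z. \<omega> t k z $ j) z)\<^sup>2))"
      using moments by (intro *; force simp: I_def)+
    then show "integrable M (\<lambda>z. (\<Sum>k<K. \<omega> t k z $ j)\<^sup>2)"
      "expectation (\<lambda>z. (\<Sum>k<K. \<omega> t k z $ j)\<^sup>2) = real K * v j"
      unfolding I_def sum.reindex[OF inj] using moments(4) by simp_all
  qed
  have norm: "(norm (\<Sum>k<K. \<omega> t k z))\<^sup>2 = (\<Sum>j\<in>UNIV. (\<Sum>k<K. \<omega> t k z $ j)\<^sup>2)" for z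
    unfolding power2_norm_eq_inner by (simp add: inner_vec_def sum_component power2_eq_square)
  show int_sq: "integrable M (\<lambda>z. (norm (\<Sum>k<K. \<omega> t k z))\<^sup>2)"
    "expectation (\<lambda>z. (norm (\<Sum>k<K. \<omega> t k z))\<^sup>2) = real K * (\<Sum>j\<in>UNIV. v j)"
    unfolding norm using coord by (simp_all add: Bochner_Integration.integral_sum sum_distrib_left)
  have "(\<lambda>z. \<Sum>k<K. \<omega> t k z) \<in> borel_measurable M"
  proof (intro borel_measurable_sum)
    fix k assume "k \<in> {..<K}"
    then have "(\<lambda>z. \<chi> j. \<omega> t k z $ j) \<in> borel_measurable M"
      using rv by (intro borel_measurable_vec_lambda) simp
    then show "\<omega> t k \<in> borel_measurable M" by simp
  qed
  then have int: "integrable M (\<lambda>z. \<Sum>k<K. \<omega> t k z)"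
    by (rule integrable_of_integrable_norm_square[OF _ int_sq(1)])
  show "expectation (\<lambda>z. \<Sum>k<K. \<omega> t k z) = 0"
  proof (rule vec_eq_iff[THEN iffD2], rule)
    fix j
    have "expectation (\<lambda>z. \<Sum>k<K. \<omega> t k z) $ j = expectation (\<lambda>z. (\<Sum>k<K. \<omega> t k z) \<bullet> axis j 1)"
      by (subst integral_inner_left[OF int]) (simp add: inner_axis)
    also have "\<dots> = expectation (\<lambda>z. \<Sum>k<K. \<omega> t k z $ j)"
      by (simp add: inner_axis sum_component)
    also have "\<dots> = 0" using moments(1,2) by (simp add: Bochner_Integration.integral_sum)
    finally show "expectation (\<lambda>z. \<Sum>k<K. \<omega> t k z) $ j = 0 $ j" by simp
  qed
qed

section \<open>The convergence bound\<close>

lemma rho_pos: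
  assumes "0 < \<epsilon>" "0 < \<delta>" "\<delta> \<le> 1"
  shows "0 < rho \<epsilon> \<delta>"
proof -
  have "0 \<le> ln (1 / \<delta>)" using assms by simp
  then have "sqrt (ln (1 / \<delta>)) < sqrt (ln (1 / \<delta>) + \<epsilon>)" using assms by simp
  then show ?thesis by (simp add: rho_def)
qed

theorem theorem2p4:
  fixes c :: "real^'m::finite"
    and K T :: nat
    and D :: "nat \<Rightarrow> 'm private_data"
    and \<sigma> :: "nat \<Rightarrow> real^'m \<Rightarrow> (nat \<Rightarrow> real) \<times> (real^'m)"
    and x_opt :: "nat \<Rightarrow> nat \<Rightarrow> real"
    and s_opt :: "nat \<Rightarrow> real^'m"
    and mu_opt :: "real^'m"
    and \<epsilon> \<delta> M :: real
    and P :: "'a measure"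
    and \<omega> :: "nat \<Rightarrow> nat \<Rightarrow> 'a \<Rightarrow> real^'m"
  assumes "K > 1" and "0 \<le> c"
    and "resource_sharing_optimal c K D x_opt s_opt"
    and "dual_optimal c K D mu_opt"
    and "\<And>k. k < K \<Longrightarrow> argmax_selection c (D k) (\<sigma> k)"
    and "\<epsilon> > 0" and "0 < \<delta>" and "\<delta> \<le> 1" and "T \<ge> 1"
    and "M > 0" and "norm (0 - mu_opt) \<le> M"
    and "prob_space P"
    and "prob_space.indep_vars P (\<lambda>_. borel) (\<lambda>(t, k, j) z. \<omega> t k z $ j)
           ({..<T} \<times> {..<K} \<times> UNIV)"
    and "\<And>t k j. t < T \<Longrightarrow> k < K \<Longrightarrow>
           distr P borel (\<lambda>z. \<omega> t k z $ j)
             = gaussian 0 (real T * real CARD('m) * (c $ j)\<^sup>2 / (2 * rho \<epsilon> \<delta>))"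
  shows "\<exists>\<nu>>0.
    (\<forall>t\<le>T. integrable P
       (\<lambda>z. optimality_gap c K D \<sigma> x_opt s_opt mu_opt (\<lambda>_. \<nu>) (\<lambda>t k. \<omega> t k z) t)) \<and>
    (MIN t\<in>{0..T}. integral\<^sup>L P
       (\<lambda>z. optimality_gap c K D \<sigma> x_opt s_opt mu_opt (\<lambda>_. \<nu>) (\<lambda>t k. \<omega> t k z) t))
    \<le> M * (norm c * sqrt (real T * real CARD('m) * real K / (2 * rho \<epsilon> \<delta>) + (real K - 1)\<^sup>2))
        / sqrt (real T)"
proof -
  interpret prob_space P by fact
  interpret relaxed_resource_sharing c K D \<sigma> by standard (rule assms(5))
  have "0 < rho \<epsilon> \<delta>" by (rule rho_pos[OF assms(6,7,8)])
  define N where "N = real T * real CARD('m) * real K / (2 * rho \<epsilon> \<delta>)"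
  define b where "b = sqrt (N + (real K - 1)\<^sup>2)"
  define F where "F \<mu> = dual \<mu> - lagrangian c K D x_opt s_opt mu_opt" for \<mu>
  have "0 \<le> N" using \<open>0 < rho \<epsilon> \<delta>\<close> by (simp add: N_def)
  then have "0 < b" using \<open>K > 1\<close> by (simp add: b_def add_nonneg_pos)
  have b2: "b\<^sup>2 = N + (real K - 1)\<^sup>2" using \<open>0 \<le> N\<close> by (simp add: b_def)
  have F_dual: "F \<mu> = dual \<mu> - dual mu_opt" for \<mu>
    unfolding F_def strong_duality[OF assms(3,4)] ..
  have F_nonneg: "0 \<le> F \<mu>" for \<mu>
    using assms(4) unfolding F_dual dual_optimal_def is_arg_min_linorder dual_eq by simp
  have F_le: "F \<mu> \<le> slack \<mu> \<bullet> (\<mu> - mu_opt)" for \<mu>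
    using dual_subgradient[of \<mu> mu_opt] by (simp add: F_dual inner_diff_right)
  have "F \<in> borel_measurable borel"
    using measurable_dual by (simp add: F_def[abs_def])
  let ?l = "\<lambda>\<nu> t z. multiplier c K \<sigma> (\<lambda>_. \<nu>) (\<lambda>i k. \<omega> i k z) t"
  have noise_var: "real K * (\<Sum>j\<in>UNIV. real T * real CARD('m) * (c $ j)\<^sup>2 / (2 * rho \<epsilon> \<delta>)) = (norm c)\<^sup>2 * N"
    unfolding power2_norm_eq_inner inner_vec_def N_def
    by (simp add: sum_divide_distrib[symmetric] sum_distrib_left[symmetric] power2_eq_square)
  have descent: "(\<forall>t\<le>T. integrable P (\<lambda>z. F (?l \<nu> t z))) \<and>
      2 * \<nu> * (\<Sum>t<T. expectation (\<lambda>z. F (?l \<nu> t z))) \<le> M\<^sup>2 + real T * (\<nu>\<^sup>2 * (norm c * b)\<^sup>2)"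
    if "0 < \<nu>" for \<nu>
  proof -
    have "(norm (0 - mu_opt))\<^sup>2 \<le> M\<^sup>2" using assms(11) by (intro power_mono) auto
    moreover have "((real K - 1) * norm c)\<^sup>2 + (norm c)\<^sup>2 * N = (norm c * b)\<^sup>2"
      unfolding power_mult_distrib b2 by (simp add: distrib_left mult.commute)
    moreover note noise = gaussian_noise_sum_moments[OF assms(13,14), unfolded noise_var]
    note noisy_subgradient_descent[where T = T and l = "?l \<nu>" and \<xi> = "\<lambda>t z. \<Sum>k<K. \<omega> t k z",
        OF \<open>F \<in> _\<close> F_nonneg F_le measurable_slack norm_slack_le[OF \<open>K > 1\<close>] _ multiplier_Suc
          indep_multiplier_noise[OF prob_space_axioms assms(13)] noise(1,2) eq_refl[OF noise(3)] that]
    ultimately show ?thesis using \<open>0 < rho \<epsilon> \<delta>\<close> by auto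
  qed
  have gap: "optimality_gap c K D \<sigma> x_opt s_opt mu_opt (\<lambda>_. \<nu>) (\<lambda>t k. \<omega> t k z) t = F (?l \<nu> t z)" for \<nu> t z
    unfolding optimality_gap_eq F_def ..
  have "\<exists>\<nu>>0. (MIN t\<in>{0..T}. expectation (\<lambda>z. F (?l \<nu> t z))) \<le> M * (norm c * b) / sqrt (real T)"
  proof (cases "c = 0")
    \<comment> \<open>Nothing can be allocated, so every multiplier is dual optimal. The general choice of the
      step-size would divide by \<open>norm c = 0\<close> here.\<close>
    case True
    have "slack \<mu> = 0" for \<mu>
      using norm_slack_le[OF \<open>K > 1\<close>, of \<mu>] True by simp
    then have "F \<mu> = 0" for \<mu> using F_le[of \<mu>] F_nonneg[of \<mu>] by simp
    then show ?thesis using True by (intro exI[of _ 1]) simp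
  next
    case False
    define R where "R = norm c * b"
    \<comment> \<open>This step-size balances the two terms \<open>M\<^sup>2\<close> and \<open>T \<nu>\<^sup>2 R\<^sup>2\<close> of the descent estimate.\<close>
    define \<nu> where "\<nu> = M / (R * sqrt (real T))"
    define m where "m = (MIN t\<in>{0..T}. expectation (\<lambda>z. F (?l \<nu> t z)))"
    have "0 < R" using False \<open>0 < b\<close> by (simp add: R_def)
    have "0 < sqrt (real T)" using \<open>T \<ge> 1\<close> by simp
    have "0 < \<nu>" using \<open>M > 0\<close> \<open>0 < R\<close> \<open>0 < sqrt (real T)\<close> by (simp add: \<nu>_def)
    have "m \<le> expectation (\<lambda>z. F (?l \<nu> t z))" if "t < T" for t
      unfolding m_def using that by (intro Min_le) auto
    then have "real T * m \<le> (\<Sum>t<T. expectation (\<lambda>z. F (?l \<nu> t z)))"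
      using sum_bounded_below[of "{..<T}" m] by simp
    then have "2 * \<nu> * (real T * m) \<le> 2 * \<nu> * (\<Sum>t<T. expectation (\<lambda>z. F (?l \<nu> t z)))"
      using \<open>0 < \<nu>\<close> by simp
    also have "\<dots> \<le> M\<^sup>2 + real T * (\<nu>\<^sup>2 * R\<^sup>2)" using descent[OF \<open>0 < \<nu>\<close>] by (simp add: R_def)
    also have "real T * (\<nu>\<^sup>2 * R\<^sup>2) = M\<^sup>2"
      using \<open>0 < R\<close> \<open>T \<ge> 1\<close> by (simp add: \<nu>_def power_divide power_mult_distrib)
    finally have "\<nu> * real T * m \<le> M\<^sup>2" by simp
    moreover have "\<nu> * real T = M * sqrt (real T) / R"
      using \<open>0 < sqrt (real T)\<close> by (simp add: \<nu>_def real_div_sqrt divide_simps)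
    ultimately have "M * (sqrt (real T) * m) \<le> M * (M * R)"
      using \<open>0 < R\<close> by (simp add: divide_simps power2_eq_square mult_ac)
    then have "m \<le> M * R / sqrt (real T)"
      using \<open>M > 0\<close> \<open>0 < sqrt (real T)\<close> by (simp add: divide_simps mult_ac)
    then show ?thesis using \<open>0 < \<nu>\<close> unfolding m_def R_def by blast
  qed
  then show ?thesis unfolding gap using descent unfolding b_def N_def by blast
qed

end
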